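(* For $k\ge 3$ let $R(k)$ denote (the vertex set of) a regular $k$-gon. Then \[ S_{R(4)}'(n)\geq\Omega(n^{\log 144/\log 24})\geq\Omega(n^{1.563}),\qquad S_{R(6)}'(n)\geq\Omega(n^{\log 528/\log 84})\geq\Omega(n^{1.414}), \] \[ S_{R(8)}'(n)\geq\Omega(n^{\log 1312/\log 208})\geq\Omega(n^{1.345}),\qquad S_{R(10)}'(n)\geq\Omega(n^{\log 2640/\log 420})\geq\Omega(n^{1.304}), \] \[ S_{R(5)}'(n)\geq\Omega(n^{\log 1440/\log 120})\geq\Omega(n^{1.519}). \]
   Context: Identify the plane with $\mathbb{C}$. Sets $A,B$ are similar if $B=zA+w$ for some $z,w\in\mathbb{C}$, $z\neq0$. $S_P(Q)$ is the number of subsets of $Q$ similar to $P$. $S'_P(n)$ is the maximum of $S_P(Q)$ over all $n$-point sets $Q\subseteq\mathbb{C}$ with no three collinear points. *)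

theory Defs
  imports "HOL-Analysis.Analysis" "HOL-Library.Landau_Symbols"
begin

definition similar_sets :: "complex set \<Rightarrow> complex set \<Rightarrow> bool" where
  "similar_sets A B \<longleftrightarrow> (\<exists>z w. z \<noteq> 0 \<and> B = (\<lambda>x. z * x + w) ` A)"

definition sim_count :: "complex set \<Rightarrow> complex set \<Rightarrow> nat" where
  "sim_count P Q = card {B. B \<subseteq> Q \<and> similar_sets P B}"

definition no_three_collinear :: "complex set \<Rightarrow> bool" where
  "no_three_collinear Q \<longleftrightarrow>
     (\<forall>a\<in>Q. \<forall>b\<in>Q. \<forall>c\<in>Q. a \<noteq> b \<and> a \<noteq> c \<and> b \<noteq> c \<longrightarrow> \<not> collinear {a, b, c})"

text \<open>The set of counts is finite (each is at most \<open>2 ^ n\<close>) and nonempty (take \<open>n\<close> points on a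
  circle), so \<open>Max\<close> is a genuine maximum.\<close>

definition max_sim_count :: "complex set \<Rightarrow> nat \<Rightarrow> nat" where
  "max_sim_count P n =
     Max {sim_count P Q | Q. finite Q \<and> card Q = n \<and> no_three_collinear Q}"

text \<open>Vertex sets of regular \<open>k\<close>-gons: \<open>c\<close> is the centre and \<open>r\<close> the vector from the centre to
  one of the vertices.\<close>

definition regular_polygon :: "nat \<Rightarrow> complex set \<Rightarrow> bool" where
  "regular_polygon k P \<longleftrightarrow>
     k \<ge> 3 \<and> (\<exists>c r. r \<noteq> 0 \<and> P = (\<lambda>j. c + r * cis (2 * pi * real j / real k)) ` {..<k})"

end

theory Submission
  imports Defs "HOL-Computational_Algebra.Polynomial"
begin

text \<open>Count affine maps \<open>w \<mapsto> c + r * w\<close> sending all \<open>k\<close>-th roots of unity into a set, the constant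
  maps (\<open>r = 0\<close>) included. This count is multiplicative on Cartesian products, so a set \<open>A\<close> of \<open>N\<close>
  points carrying \<open>M\<close> maps has a \<open>j\<close>-th power with \<open>N ^ j\<close> points and \<open>M ^ j\<close> maps, only \<open>N ^ j\<close> of
  them constant. A generic functional \<open>(x, y) \<mapsto> x + u * y\<close> brings a product back to the plane without
  creating collinear triples, which gives the exponent \<open>ln M / ln N\<close>.

  The initial sets lie on a sphere of \<open>\<complex>\<^sup>2\<close>, hence contain no collinear triple. For even \<open>k\<close>, take all
  \<open>(x * (1 + w), y * (1 - w))\<close> with \<open>k\<close>-th roots of unity \<open>x, y, w\<close> (for \<open>k = 4\<close> this is the 24-cell);
  for the pentagon, take the vertices of the 600-cell.\<close>

section \<open>Sets without collinear triples\<close>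

text \<open>The parameter form makes sense in every real vector space and passes to the coordinates
  of a product with the same \<open>s\<close>. The degenerate case \<open>a = c\<close> is harmless,
  since it forces \<open>b = a\<close>.\<close>

definition no3 :: "'a::real_vector set \<Rightarrow> bool" where
  "no3 V \<longleftrightarrow> (\<forall>a\<in>V. \<forall>b\<in>V. \<forall>c\<in>V. \<forall>s. b = a + s *\<^sub>R (c - a) \<longrightarrow> b = a \<or> b = c)"

lemma no3D:
  assumes "no3 V" "a \<in> V" "b \<in> V" "c \<in> V" "b - a = s *\<^sub>R (c - a)"
  shows "b = a \<or> b = c"
proof -
  have "b = a + s *\<^sub>R (c - a)" using assms(5) by (simp add: algebra_simps)
  with assms show ?thesis unfolding no3_def by blast
qed

lemma no3_imp_no_three_collinear:
  assumes "no3 Q"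
  shows "no_three_collinear Q"
  unfolding no_three_collinear_def
proof (intro ballI impI notI)
  fix a b c assume Q: "a \<in> Q" "b \<in> Q" "c \<in> Q" and d: "a \<noteq> b \<and> a \<noteq> c \<and> b \<noteq> c"
    and col: "collinear {a, b, c}"
  then obtain u where "b = u *\<^sub>R a + (1 - u) *\<^sub>R c" unfolding collinear_3_expand by blast
  then have "b - a = (1 - u) *\<^sub>R (c - a)" by (simp add: algebra_simps)
  with no3D[OF assms Q] d show False by blast
qed

text \<open>Both coordinates share the parameter \<open>s\<close>. Unless \<open>s\<close> is 0 or
  1, a coordinate in which \<open>b\<close> agrees with \<open>a\<close> or \<open>c\<close> must be
  equal at all three points, so \<open>b = a\<close>.\<close>

lemma no3_Times:
  assumes A: "no3 A" and B: "no3 B"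
  shows "no3 (A \<times> B)"
  unfolding no3_def
proof (intro ballI allI impI)
  fix a b c s assume V: "a \<in> A \<times> B" "b \<in> A \<times> B" "c \<in> A \<times> B" and eq: "b = a + s *\<^sub>R (c - a)"
  have f: "fst b - fst a = s *\<^sub>R (fst c - fst a)" and g: "snd b - snd a = s *\<^sub>R (snd c - snd a)"
    using eq by simp_all
  then have 1: "fst b = fst a \<or> fst b = fst c" and 2: "snd b = snd a \<or> snd b = snd c"
    using no3D[OF A, of "fst a" "fst b" "fst c" s] no3D[OF B, of "snd a" "snd b" "snd c" s] V
    by (auto simp: mem_Times_iff)
  show "b = a \<or> b = c"
  proof (cases "s = 0 \<or> s = 1")
    case True then show ?thesis using eq by auto
  next
    case False
    have "fst b = fst a"
    proof (rule ccontr)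
      assume n: "fst b \<noteq> fst a"
      then have "fst b = fst c" using 1 by blast
      then have "(s - 1) *\<^sub>R (fst c - fst a) = 0"
        using f by (simp add: scaleR_diff_left)
      then show False using False n \<open>fst b = fst c\<close> by auto
    qed
    moreover have "snd b = snd a"
    proof (rule ccontr)
      assume n: "snd b \<noteq> snd a"
      then have "snd b = snd c" using 2 by blast
      then have "(s - 1) *\<^sub>R (snd c - snd a) = 0"
        using g by (simp add: scaleR_diff_left)
      then show False using False n \<open>snd b = snd c\<close> by auto
    qed
    ultimately show ?thesis by (simp add: prod_eq_iff)
  qed
qed

text \<open>Strict convexity: the squared norm at a point of a chord differs from the interpolated
  one by \<open>s * (1 - s)\<close> times the squared chord length, which must therefore
  vanish.\<close>

lemma no3_sphere:
  fixes V :: "'a::real_inner set"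
  assumes "\<And>v. v \<in> V \<Longrightarrow> norm v = R"
  shows "no3 V"
  unfolding no3_def
proof (intro ballI allI impI)
  fix a b c s assume V: "a \<in> V" "b \<in> V" "c \<in> V" and eq: "b = a + s *\<^sub>R (c - a)"
  have n: "inner a a = R\<^sup>2" "inner b b = R\<^sup>2" "inner c c = R\<^sup>2"
    using V assms by (simp_all flip: power2_norm_eq_inner)
  have "inner b b = (1 - s) * inner a a + s * inner c c - s * (1 - s) * inner (c - a) (c - a)"
    unfolding eq by (simp add: algebra_simps inner_commute)
  with n have "s * (1 - s) * inner (c - a) (c - a) = 0" by (simp add: algebra_simps)
  then show "b = a \<or> b = c" using eq by auto
qed

section \<open>Generic projections to the plane\<close>

text \<open>Both a projection direction and a new point in general position are found by avoiding
  finitely many conditions of this shape; each bad set is a line, a circle, a point or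
  empty.\<close>

lemma exists_avoiding:
  assumes "finite I" "\<And>e c d. (e, c, d) \<in> I \<Longrightarrow> e \<noteq> 0 \<or> c \<noteq> 0 \<or> d \<noteq> 0"
  shows "\<exists>u::complex. \<forall>(e, c, d)\<in>I. e + Im (u * c) + d * (cmod u)\<^sup>2 \<noteq> 0"
proof -
  \<comment> \<open>On the parabola \<open>u = t + t\<^sup>2 * \<i>\<close> the condition becomes a nonzero polynomial in \<open>t\<close>.\<close>
  define q where "q = (\<lambda>(e, c, d). [:e, Im c, Re c + d, 0, d:] :: real poly)"
  have q: "poly (q (e, c, d)) t = e + Im (Complex t (t\<^sup>2) * c) + d * (cmod (Complex t (t\<^sup>2)))\<^sup>2"
    for e c d t
    unfolding q_def cmod_power2 by (simp add: algebra_simps power2_eq_square)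
  have "q x \<noteq> 0" if "x \<in> I" for x
    using assms(2)[of "fst x" "fst (snd x)" "snd (snd x)"] that
    by (auto simp: q_def complex_eq_iff split: prod.splits)
  then have "finite (\<Union>x\<in>I. {t. poly (q x) t = 0})"
    using assms(1) by (auto intro: poly_roots_finite)
  then obtain t where "t \<notin> (\<Union>x\<in>I. {t. poly (q x) t = 0})"
    by (meson ex_new_if_finite infinite_UNIV_char_0)
  then show ?thesis
    by (intro exI[of _ "Complex t (t\<^sup>2)"]) (use q in fastforce)
qed

lemma Im_mult_cnj_eq_0_imp_real_multiple:
  assumes "Im (x * cnj y) = 0" "y \<noteq> 0"
  shows "\<exists>s. x = s *\<^sub>R y"
proof -
  have "Im (x / y) = 0" using assms by (simp add: Im_complex_div_eq_0)
  then have "x / y = of_real (Re (x / y))" by (simp add: complex_eq_iff)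
  then have "x = Re (x / y) *\<^sub>R y" using assms(2) by (metis nonzero_divide_eq_eq scaleR_conv_of_real)
  then show ?thesis by blast
qed

text \<open>\<open>Im (x * cnj y)\<close> is, up to sign, the determinant of two plane vectors. For
  the projected vectors it is an expression in \<open>u\<close> as in
  \<open>exists_avoiding\<close>, whose coefficients all vanish only if \<open>v\<close> and
  \<open>w\<close> are dependent over the reals.\<close>

lemma exists_projection:
  fixes E :: "((complex \<times> complex) \<times> (complex \<times> complex)) set"
  assumes "finite E" "\<And>v w s. (v, w) \<in> E \<Longrightarrow> w \<noteq> 0 \<and> v \<noteq> s *\<^sub>R w"
  shows "\<exists>u. \<forall>(v, w)\<in>E. Im ((fst v + u * snd v) * cnj (fst w + u * snd w)) \<noteq> 0"
proof -
  \<comment> \<open>Coefficients of the expanded determinant;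
    \<open>Im (cnj u * x) = - Im (u * cnj x)\<close> merges the two mixed terms into one.\<close>
  define T where "T = (\<lambda>(v::complex \<times> complex, w). (Im (fst v * cnj (fst w)),
      snd v * cnj (fst w) - cnj (fst v) * snd w, Im (snd v * cnj (snd w))))"
  have "\<exists>u::complex. \<forall>(e, c, d)\<in>T ` E. e + Im (u * c) + d * (cmod u)\<^sup>2 \<noteq> 0"
  proof (rule exists_avoiding)
    show "finite (T ` E)" using assms(1) by simp
    fix e c d assume "(e, c, d) \<in> T ` E"
    then obtain v1 v2 w1 w2 where vw: "((v1, v2), (w1, w2)) \<in> E" "e = Im (v1 * cnj w1)"
        "c = v2 * cnj w1 - cnj v1 * w2" "d = Im (v2 * cnj w2)"
      by (auto simp: T_def)
    show "e \<noteq> 0 \<or> c \<noteq> 0 \<or> d \<noteq> 0"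
    proof (rule ccontr)
      assume "\<not> ?thesis"
      then have z: "Im (v1 * cnj w1) = 0" "v2 * cnj w1 = cnj v1 * w2" "Im (v2 * cnj w2) = 0"
        using vw by auto
      show False
      proof (cases "w1 = 0")
        case False
        obtain s where v1: "v1 = s *\<^sub>R w1"
          using Im_mult_cnj_eq_0_imp_real_multiple z(1) False by blast
        then have "v2 * cnj w1 = (s *\<^sub>R w2) * cnj w1" using z(2) by simp
        then have "v2 = s *\<^sub>R w2" using False by (simp only: mult_cancel_right) simp
        then show False using assms(2)[OF vw(1), of s] v1 by simp
      next
        case True
        then have w2: "w2 \<noteq> 0" using assms(2)[OF vw(1)] by (auto simp: zero_prod_def)
        then have "v1 = 0" using z(2) True by simp
        then show False
          using assms(2)[OF vw(1)] Im_mult_cnj_eq_0_imp_real_multiple[OF z(3) w2] True by auto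
      qed
    qed
  qed
  then obtain u where u: "\<And>e c d. (e, c, d) \<in> T ` E \<Longrightarrow> e + Im (u * c) + d * (cmod u)\<^sup>2 \<noteq> 0"
    by fast
  have "Im ((v1 + u * v2) * cnj (w1 + u * w2)) \<noteq> 0" if "((v1, v2), (w1, w2)) \<in> E" for v1 v2 w1 w2
  proof -
    have "(Im (v1 * cnj w1), v2 * cnj w1 - cnj v1 * w2, Im (v2 * cnj w2)) \<in> T ` E"
      using that by (force simp: T_def)
    from u[OF this]
    show ?thesis unfolding cmod_power2 by (simp add: algebra_simps power2_eq_square)
  qed
  then show ?thesis by (intro exI[of _ u]) auto
qed

text \<open>A collinear triple of images would make two projected differences dependent. The
  corresponding differences in \<open>V\<close> are independent, and a generic \<open>u\<close>
  keeps them so.\<close>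

lemma exists_no3_projection:
  fixes V :: "(complex \<times> complex) set"
  assumes V: "finite V" "no3 V"
  shows "\<exists>u. inj_on (\<lambda>v. fst v + u * snd v) V \<and> no3 ((\<lambda>v. fst v + u * snd v) ` V)"
proof -
  define mul where "mul = (\<lambda>v::complex \<times> complex. (\<i> * fst v, \<i> * snd v))"
  \<comment> \<open>The pairs \<open>(v, \<i> * v)\<close> ensure that the projection of \<open>v\<close> is nonzero, hence injectivity.\<close>
  define E where
    "E = (\<Union>a\<in>V. \<Union>b\<in>V - {a}. insert (b - a, mul (b - a)) ((\<lambda>c. (b - a, c - a)) ` (V - {a, b})))"
  have fin: "finite E" unfolding E_def using V(1) by simp
  have ind: "w \<noteq> 0 \<and> v \<noteq> s *\<^sub>R w" if "(v, w) \<in> E" for v w s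
    using that unfolding E_def
  proof (elim UN_E insertE imageE DiffE)
    fix a b c assume "(v, w) = (b - a, c - a)" "a \<in> V" "b \<in> V" "c \<in> V" "b \<notin> {a}" "c \<notin> {a, b}"
    then show ?thesis using no3D[OF V(2), of a b c s] by auto
  next
    fix a b assume "(v, w) = (b - a, mul (b - a))" "b \<notin> {a}"
    then have vw: "v \<noteq> 0" "w = mul v" by auto
    have "y = 0" if "y = s *\<^sub>R (\<i> * y)" for y :: complex
    proof -
      from that have "y * (1 - s * \<i>) = 0" by (simp add: algebra_simps scaleR_conv_of_real)
      moreover have "1 - s * \<i> \<noteq> 0" by (simp add: complex_eq_iff)
      ultimately show ?thesis by simp
    qed
    then show ?thesis using vw by (auto simp: mul_def prod_eq_iff)
  qed
  obtain u where u: "\<And>v w. (v, w) \<in> E \<Longrightarrow> Im ((fst v + u * snd v) * cnj (fst w + u * snd w)) \<noteq> 0"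
    using exists_projection[OF fin] ind by blast
  define p where "p = (\<lambda>v. fst v + u * snd v)"
  have pd: "p (b - a) = p b - p a" for a b by (simp add: p_def algebra_simps)
  have u: "(v, w) \<in> E \<Longrightarrow> Im (p v * cnj (p w)) \<noteq> 0" for v w using u by (simp add: p_def)
  have inj: "inj_on p V"
  proof (rule inj_onI, rule ccontr)
    fix a b assume "a \<in> V" "b \<in> V" "p a = p b" "a \<noteq> b"
    moreover from this have "(b - a, mul (b - a)) \<in> E" unfolding E_def by blast
    ultimately show False using u[of "b - a" "mul (b - a)"] pd[of b a] by simp
  qed
  have "no3 (p ` V)"
    unfolding no3_def
  proof (intro ballI allI impI)
    fix x y z s assume "x \<in> p ` V" "y \<in> p ` V" "z \<in> p ` V" and eq: "y = x + s *\<^sub>R (z - x)"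
    then obtain a b c where abc: "a \<in> V" "b \<in> V" "c \<in> V" "x = p a" "y = p b" "z = p c" by blast
    show "y = x \<or> y = z"
    proof (cases "a \<noteq> b \<and> a \<noteq> c \<and> b \<noteq> c")
      case False then show ?thesis using abc eq by auto
    next
      case True
      then have "(b - a, c - a) \<in> E" using abc unfolding E_def by blast
      moreover have "p (b - a) = s *\<^sub>R p (c - a)" using eq abc by (simp add: pd)
      ultimately show ?thesis using u by fastforce
    qed
  qed
  with inj show ?thesis unfolding p_def by blast
qed

section \<open>Enlarging planar sets without collinear triples\<close>

lemma no3_complex_iff:
  fixes Q :: "complex set"
  shows "no3 Q \<longleftrightarrow> (\<forall>a\<in>Q. \<forall>b\<in>Q. \<forall>c\<in>Q. a \<noteq> b \<and> a \<noteq> c \<and> b \<noteq> c \<longrightarrow> Im ((b - a) * cnj (c - a)) \<noteq> 0)"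
    (is "_ \<longleftrightarrow> ?R")
proof
  assume Q: "no3 Q"
  show ?R
  proof (intro ballI impI notI)
    fix a b c assume abc: "a \<in> Q" "b \<in> Q" "c \<in> Q" "a \<noteq> b \<and> a \<noteq> c \<and> b \<noteq> c"
      and "Im ((b - a) * cnj (c - a)) = 0"
    then obtain s where "b - a = s *\<^sub>R (c - a)"
      using Im_mult_cnj_eq_0_imp_real_multiple[of "b - a" "c - a"] by auto
    from no3D[OF Q abc(1-3) this] show False using abc(4) by blast
  qed
next
  assume R: ?R
  show "no3 Q"
    unfolding no3_def
  proof (intro ballI allI impI)
    fix a b c s assume abc: "a \<in> Q" "b \<in> Q" "c \<in> Q" and eq: "b = a + s *\<^sub>R (c - a)"
    have "b - a = s *\<^sub>R (c - a)" using eq by simp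
    then have "Im ((b - a) * cnj (c - a)) = s * Im ((c - a) * cnj (c - a))" by simp
    moreover have "Im ((c - a) * cnj (c - a)) = 0" by (simp add: algebra_simps)
    ultimately have "Im ((b - a) * cnj (c - a)) = 0" by simp
    then have "a = b \<or> a = c \<or> b = c" using R abc by blast
    then show "b = a \<or> b = c" using eq by auto
  qed
qed

text \<open>The new point has to avoid the points of \<open>Q\<close> and the lines through two of
  them.\<close>

lemma exists_no3_insert:
  fixes Q :: "complex set"
  assumes "finite Q" "no3 Q"
  shows "\<exists>u. u \<notin> Q \<and> no3 (insert u Q)"
proof -
  \<comment> \<open>The first triple encodes the squared distance of \<open>u\<close> and
    \<open>a\<close>, the others the determinant \<open>Im ((u - a) * cnj (c - a))\<close>, which
    vanishes on the line through \<open>a\<close> and \<open>c\<close>.\<close>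
  define I where "I = (\<Union>a\<in>Q. insert ((cmod a)\<^sup>2, - 2 * \<i> * cnj a, 1)
    ((\<lambda>c. (- Im (a * cnj (c - a)), cnj (c - a), 0::real)) ` (Q - {a})))"
  have "finite I" unfolding I_def using assms by simp
  moreover have "e \<noteq> 0 \<or> c \<noteq> 0 \<or> d \<noteq> 0" if "(e, c, d) \<in> I" for e c d
    using that unfolding I_def by auto
  ultimately obtain u where u: "\<And>e c d. (e, c, d) \<in> I \<Longrightarrow> e + Im (u * c) + d * (cmod u)\<^sup>2 \<noteq> 0"
    using exists_avoiding[of I] by fast
  have cross: "Im ((u - a) * cnj (c - a)) \<noteq> 0" if "a \<in> Q" "c \<in> Q" "a \<noteq> c" for a c
  proof -
    have "(- Im (a * cnj (c - a)), cnj (c - a), 0) \<in> I" unfolding I_def using that by blast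
    from u[OF this] show ?thesis by (simp add: algebra_simps)
  qed
  have 2: "u \<notin> Q"
  proof
    assume "u \<in> Q"
    then have "((cmod u)\<^sup>2, - 2 * \<i> * cnj u, 1) \<in> I" unfolding I_def by blast
    from u[OF this] show False unfolding cmod_power2 by (simp add: power2_eq_square)
  qed
  have "Im ((b - a) * cnj (c - a)) \<noteq> 0"
    if abc: "a \<in> insert u Q" "b \<in> insert u Q" "c \<in> insert u Q" "a \<noteq> b \<and> a \<noteq> c \<and> b \<noteq> c" for a b c
  proof -
    \<comment> \<open>Cyclic invariance and antisymmetry of the determinant reduce every position of
      the new point to \<open>cross\<close>.\<close>
    have perm: "Im ((b - a) * cnj (c - a)) = Im ((a - c) * cnj (b - c))"
        "Im ((b - a) * cnj (c - a)) = - Im ((c - a) * cnj (b - a))"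
      by (simp_all add: algebra_simps)
    consider "a = u" | "b = u" | "c = u" | "a \<in> Q" "b \<in> Q" "c \<in> Q" using abc by blast
    then show ?thesis
    proof cases
      case 1 then show ?thesis using cross[of c b] abc perm(1)
        by (metis insertE)
    next
      case 2 then show ?thesis using cross[of a c] abc by auto
    next
      case 3 then show ?thesis using cross[of a b] abc perm(2) by auto
    next
      case 4 then show ?thesis using assms(2) abc(4) unfolding no3_complex_iff by blast
    qed
  qed
  with 2 show ?thesis unfolding no3_complex_iff by blast
qed

lemma exists_no3_superset:
  fixes Q :: "complex set"
  assumes "finite Q" "no3 Q" "card Q \<le> n"
  shows "\<exists>Q'. Q \<subseteq> Q' \<and> finite Q' \<and> card Q' = n \<and> no3 Q'"
  using assms(3)
proof (induction n rule: dec_induct)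
  case base then show ?case using assms by blast
next
  case (step n)
  then obtain Q' where Q': "Q \<subseteq> Q'" "finite Q'" "card Q' = n" "no3 Q'" by blast
  then obtain u where "u \<notin> Q'" "no3 (insert u Q')" using exists_no3_insert by blast
  then show ?case using Q' by (intro exI[of _ "insert u Q'"]) auto
qed

section \<open>Regular polygons and their number in product sets\<close>

text \<open>Degenerate polygons, \<open>r = 0\<close>, are included; this makes the count multiplicative. Each
  polygon appears \<open>k\<close> times, once for each choice of a first vertex.\<close>

definition polygons :: "nat \<Rightarrow> complex set \<Rightarrow> (complex \<times> complex) set" where
  "polygons k Q = {(c, r). \<forall>w. w ^ k = 1 \<longrightarrow> c + r * w \<in> Q}"

text \<open>Centre and radius are grouped by coordinate, so that the polygons of
  \<open>A \<times> B\<close> literally form a Cartesian product.\<close>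

definition polygons2 :: "nat \<Rightarrow> (complex \<times> complex) set \<Rightarrow> ((complex \<times> complex) \<times> (complex \<times> complex)) set" where
  "polygons2 k V = {((c, r), (d, s)). \<forall>w. w ^ k = 1 \<longrightarrow> (c + r * w, d + s * w) \<in> V}"

lemma polygonsD:
  assumes "(c, r) \<in> polygons k Q" "w ^ k = 1"
  shows "c + r * w \<in> Q"
  using assms unfolding polygons_def by blast

lemma exists_root_of_unity_neq_1:
  assumes "2 \<le> k"
  shows "\<exists>w::complex. w ^ k = 1 \<and> w \<noteq> 1"
proof (rule ccontr)
  assume "\<not> ?thesis"
  then have "{w::complex. w ^ k = 1} \<subseteq> {1}" by blast
  then have "card {w::complex. w ^ k = 1} \<le> card {1::complex}" by (intro card_mono) auto
  then show False using assms card_roots_unity_eq[of k] by simp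
qed

lemma affine_eq_imp_eq:
  fixes c r c' r' w :: complex
  assumes "c + r = c' + r'" "c + r * w = c' + r' * w" "w \<noteq> 1"
  shows "c = c' \<and> r = r'"
proof -
  have "(r - r') * (w - 1) = 0" using assms(1,2) by algebra
  then show ?thesis using assms by auto
qed

text \<open>Two distinct vertices determine a polygon, so polygons can be counted as pairs of
  points; finiteness and the later bound in terms of \<open>sim_count\<close> rest on this.\<close>

lemma inj_on_two_vertices:
  fixes w :: complex
  assumes "w \<noteq> 1"
  shows "inj_on (\<lambda>(c, r). (c + r, c + r * w)) S"
proof (rule inj_onI, clarify)
  fix c r c' r' assume "c + r = c' + r'" "c + r * w = c' + r' * w"
  then show "c = c' \<and> r = r'" using affine_eq_imp_eq assms by blast
qed

lemma finite_polygons: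
  assumes "finite Q" "2 \<le> k"
  shows "finite (polygons k Q)"
proof -
  obtain w :: complex where w: "w ^ k = 1" "w \<noteq> 1" using exists_root_of_unity_neq_1 assms by blast
  have "inj_on (\<lambda>(c, r). (c + r, c + r * w)) (polygons k Q)"
    using inj_on_two_vertices w(2) .
  moreover have "(\<lambda>(c, r). (c + r, c + r * w)) ` polygons k Q \<subseteq> Q \<times> Q"
  proof (rule image_subsetI, clarify)
    fix c r assume cr: "(c, r) \<in> polygons k Q"
    show "c + r \<in> Q \<and> c + r * w \<in> Q" using polygonsD[OF cr, of 1] polygonsD[OF cr w(1)] by simp
  qed
  ultimately show ?thesis using assms(1) by (meson finite_SigmaI finite_subset finite_imageD)
qed

lemma polygons2_Times: "card (polygons2 k (A \<times> B)) = card (polygons k A) * card (polygons k B)"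
proof -
  have "polygons2 k (A \<times> B) = polygons k A \<times> polygons k B"
    unfolding polygons2_def polygons_def by blast
  then show ?thesis by (simp add: card_cartesian_product)
qed

text \<open>The projection is complex linear and thus maps polygons to polygons. No two are merged:
  injectivity on \<open>V\<close> recovers the vertices, and two vertices recover the
  polygon.\<close>

lemma exists_planar_projection:
  assumes V: "finite V" "no3 V" and k: "2 \<le> k"
  shows "\<exists>Q. finite Q \<and> no3 Q \<and> card Q = card V \<and> card (polygons2 k V) \<le> card (polygons k Q)"
proof -
  obtain u where u: "inj_on (\<lambda>v. fst v + u * snd v) V" "no3 ((\<lambda>v. fst v + u * snd v) ` V)"
    using exists_no3_projection[OF V] by blast
  let ?p = "\<lambda>v. fst v + u * snd v"
  let ?F = "\<lambda>((c, r), (d, s)). (c + u * d, r + u * s)"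
  obtain w :: complex where w: "w ^ k = 1" "w \<noteq> 1" using exists_root_of_unity_neq_1 k by blast
  have img: "?F ` polygons2 k V \<subseteq> polygons k (?p ` V)"
  proof (clarsimp simp: polygons_def polygons2_def)
    fix c r d s w assume "\<forall>w. w ^ k = 1 \<longrightarrow> (c + r * w, d + s * w) \<in> V" "w ^ k = (1::complex)"
    then have "(c + r * w, d + s * w) \<in> V" by blast
    then show "c + u * d + (r + u * s) * w \<in> ?p ` V"
      by (rule rev_image_eqI) (simp add: algebra_simps)
  qed
  have inj: "inj_on ?F (polygons2 k V)"
  proof (rule inj_onI, clarsimp)
    fix c r d s c' r' d' s'
    assume P: "((c, r), (d, s)) \<in> polygons2 k V" "((c', r'), (d', s')) \<in> polygons2 k V"
      and eq: "c + u * d = c' + u * d'" "r + u * s = r' + u * s'"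
    have "(c + r * x, d + s * x) = (c' + r' * x, d' + s' * x)" if "x ^ k = 1" for x
    proof (rule inj_onD[OF u(1)])
      show "(c + r * x, d + s * x) \<in> V" "(c' + r' * x, d' + s' * x) \<in> V"
        using P that by (auto simp: polygons2_def)
      show "?p (c + r * x, d + s * x) = ?p (c' + r' * x, d' + s' * x)"
        unfolding fst_conv snd_conv using eq by algebra
    qed
    from this[of 1] this[of w] w
    show "c = c' \<and> r = r' \<and> d = d' \<and> s = s'"
      using affine_eq_imp_eq[of c r c' r' w] affine_eq_imp_eq[of d s d' s' w] by auto
  qed
  have "card (polygons2 k V) \<le> card (polygons k (?p ` V))"
    using card_inj_on_le[OF inj img] finite_polygons V(1) k by simp
  then show ?thesis using u V(1) by (intro exI[of _ "?p ` V"]) (simp add: card_image)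
qed

text \<open>Each new factor is followed by a projection back to the plane, so only two complex
  coordinates ever occur. The case \<open>j = 0\<close> is a single point with its constant
  polygon.\<close>

lemma exists_power_set:
  assumes A: "finite A" "no3 A" and k: "2 \<le> k"
  shows "\<exists>Q. finite Q \<and> no3 Q \<and> card Q = card A ^ j \<and> card (polygons k A) ^ j \<le> card (polygons k Q)"
proof (induction j)
  case 0
  have "(0, 0) \<in> polygons k {0}" by (simp add: polygons_def)
  then have "1 \<le> card (polygons k {0})"
    using finite_polygons[of "{0}" k] k by (simp add: Suc_le_eq card_gt_0_iff) blast
  then show ?case by (intro exI[of _ "{0}"]) (simp add: no3_def)
next
  case (Suc j)
  then obtain Q where Q: "finite Q" "no3 Q" "card Q = card A ^ j"
      "card (polygons k A) ^ j \<le> card (polygons k Q)" by blast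
  obtain Q' where "finite Q'" "no3 Q'" "card Q' = card (A \<times> Q)"
      "card (polygons2 k (A \<times> Q)) \<le> card (polygons k Q')"
    using exists_planar_projection[of "A \<times> Q" k] no3_Times A Q k by blast
  then show ?case using Q
    by (intro exI[of _ Q'])
      (auto simp: polygons2_Times card_cartesian_product intro: order_trans[OF mult_left_mono])
qed

section \<open>From polygons to similar copies\<close>

lemma regular_polygon_roots_of_unity:
  assumes "regular_polygon k P"
  obtains c r where "r \<noteq> 0" "P = (\<lambda>w. c + r * w) ` {w. w ^ k = 1}"
proof -
  obtain c r where cr: "k \<ge> 3" "r \<noteq> 0" "P = (\<lambda>j. c + r * cis (2 * pi * real j / real k)) ` {..<k}"
    using assms unfolding regular_polygon_def by blast
  have "{w. w ^ k = 1} = (\<lambda>j. cis (2 * pi * real j / real k)) ` {..<k}"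
    using Complex.bij_betw_roots_unity[of k] cr(1) by (simp add: bij_betw_def)
  then have "P = (\<lambda>w. c + r * w) ` {w. w ^ k = 1}" unfolding cr(3) by (simp add: image_image)
  with cr(2) show thesis by (rule that)
qed

text \<open>A polygon is recorded by its vertices at 1 and at \<open>w\<close>. Constant polygons
  give diagonal pairs; any other gives a pair inside a similar copy \<open>B\<close>, which has at
  most \<open>k\<close> points and so at most \<open>k\<^sup>2\<close> pairs.\<close>

lemma card_polygons_le_sim_count:
  assumes Q: "finite Q" and P: "regular_polygon k P"
  shows "card (polygons k Q) \<le> card Q + k\<^sup>2 * sim_count P Q"
proof -
  have k: "3 \<le> k" using P by (simp add: regular_polygon_def)
  obtain c0 r0 where P_eq: "r0 \<noteq> 0" "P = (\<lambda>w. c0 + r0 * w) ` {w. w ^ k = 1}"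
    using regular_polygon_roots_of_unity[OF P] .
  obtain w :: complex where w: "w ^ k = 1" "w \<noteq> 1" using exists_root_of_unity_neq_1[of k] k by auto
  define C where "C = {B. B \<subseteq> Q \<and> similar_sets P B}"
  have fin: "finite C" unfolding C_def by (rule finite_subset[of _ "Pow Q"]) (use Q in auto)
  have cardB: "finite B \<and> card B \<le> k" if B: "B \<in> C" for B
  proof -
    have U: "finite {w::complex. w ^ k = 1}" "card {w::complex. w ^ k = 1} = k"
      using k finite_roots_unity[of k] card_roots_unity_eq[of k] by auto
    obtain z y where "B = (\<lambda>x. z * x + y) ` P" using B unfolding C_def similar_sets_def by blast
    then have "B = (\<lambda>w. z * (c0 + r0 * w) + y) ` {w. w ^ k = 1}" unfolding P_eq(2) image_image .
    then show ?thesis using card_image_le[OF U(1)] U by (metis finite_imageI)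
  qed
  let ?f = "\<lambda>(c, r). (c + r, c + r * w)"
  have inj: "inj_on ?f (polygons k Q)"
    using inj_on_two_vertices w(2) .
  have img: "?f ` polygons k Q \<subseteq> (\<lambda>q. (q, q)) ` Q \<union> (\<Union>B\<in>C. B \<times> B)"
  proof (rule image_subsetI, clarify)
    fix c r assume cr: "(c, r) \<in> polygons k Q" "(c + r, c + r * w) \<notin> (\<Union>B\<in>C. B \<times> B)"
    define B where "B = (\<lambda>w. c + r * w) ` {w. w ^ k = 1}"
    have "r = 0"
    proof (rule ccontr)
      assume r: "r \<noteq> 0"
      \<comment> \<open>This similarity takes the centre \<open>c0\<close> to \<open>c\<close> and
        the radius vector \<open>r0\<close> to \<open>r\<close>.\<close>
      have "r / r0 * (c0 + r0 * w) + (c - r / r0 * c0) = c + r * w" for w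
        using P_eq(1) by (simp add: field_simps)
      then have "B = (\<lambda>x. r / r0 * x + (c - r / r0 * c0)) ` P"
        unfolding B_def P_eq(2) image_image by (simp only:)
      moreover have "r / r0 \<noteq> 0" using r P_eq(1) by simp
      ultimately have "similar_sets P B" unfolding similar_sets_def by blast
      moreover have "B \<subseteq> Q" using cr(1) unfolding B_def polygons_def by blast
      ultimately have "B \<in> C" unfolding C_def by blast
      moreover have "c + r * 1 \<in> B" "c + r * w \<in> B" unfolding B_def using w(1) by (intro imageI; simp)+
      ultimately show False using cr(2) by auto
    qed
    moreover have "c + r \<in> Q" using polygonsD[OF cr(1), of 1] by simp
    ultimately show "(c + r, c + r * w) \<in> (\<lambda>q. (q, q)) ` Q" by auto
  qed
  have "card (polygons k Q) \<le> card ((\<lambda>q. (q, q)) ` Q \<union> (\<Union>B\<in>C. B \<times> B))"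
    by (rule card_inj_on_le[OF inj img]) (use Q fin cardB in auto)
  also have "\<dots> \<le> card ((\<lambda>q. (q, q)) ` Q) + card (\<Union>B\<in>C. B \<times> B)" by (rule card_Un_le)
  also have "\<dots> \<le> card Q + (\<Sum>B\<in>C. card (B \<times> B))"
    by (intro add_mono card_image_le Q card_UN_le fin)
  also have "(\<Sum>B\<in>C. card (B \<times> B)) \<le> (\<Sum>B\<in>C. k\<^sup>2)"
    unfolding card_cartesian_product power2_eq_square using cardB by (intro sum_mono mult_le_mono) auto
  also have "\<dots> = k\<^sup>2 * sim_count P Q" by (simp add: sim_count_def C_def)
  finally show ?thesis by simp
qed

text \<open>Padding \<open>Q\<close> to exactly \<open>n\<close> points loses no copies. This
  handles the sizes \<open>n\<close> that are not powers of the initial size.\<close>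

lemma sim_count_le_max_sim_count:
  assumes Q: "finite Q" "no3 Q" "card Q \<le> n"
  shows "sim_count P Q \<le> max_sim_count P n"
proof -
  have le: "sim_count P X \<le> 2 ^ n" if "finite X" "card X = n" for X
    unfolding sim_count_def using card_mono[of "Pow X" "{B. B \<subseteq> X \<and> similar_sets P B}"] that
    by (auto simp: card_Pow)
  obtain Q' where Q': "Q \<subseteq> Q'" "finite Q'" "card Q' = n" "no3 Q'" using exists_no3_superset[OF Q] by blast
  have "sim_count P Q \<le> sim_count P Q'" unfolding sim_count_def
    by (rule card_mono) (use Q' in \<open>auto intro: finite_subset[of _ "Pow Q'"]\<close>)
  also have "\<dots> \<le> max_sim_count P n" unfolding max_sim_count_def
  proof (rule Max_ge)
    show "finite {sim_count P Q | Q. finite Q \<and> card Q = n \<and> no_three_collinear Q}"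
      by (rule finite_subset[of _ "{..2 ^ n}"]) (use le in auto)
    show "sim_count P Q' \<in> {sim_count P Q | Q. finite Q \<and> card Q = n \<and> no_three_collinear Q}"
      using Q' no3_imp_no_three_collinear by blast
  qed
  finally show ?thesis .
qed

text \<open>For \<open>n\<close> between \<open>N ^ j\<close> and \<open>N ^ Suc j\<close>, the
  \<open>j\<close>-th power gives at least \<open>M ^ j - N ^ j\<close> nonconstant polygons, a
  fixed proportion of \<open>M ^ j\<close>, while \<open>n powr e\<close> is at most
  \<open>M ^ Suc j\<close> because \<open>N powr e = M\<close>.\<close>

lemma max_sim_count_bigomega:
  fixes V :: "(complex \<times> complex) set"
  assumes V: "finite V" "no3 V" "card V = N" and MN: "1 < N" "N < M" "M \<le> card (polygons2 k V)"
    and P: "regular_polygon k P"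
  shows "(\<lambda>n. real (max_sim_count P n)) \<in> \<Omega>(\<lambda>n. real n powr (ln (real M) / ln (real N)))"
proof -
  define e where "e = ln (real M) / ln (real N)"
  have k: "3 \<le> k" using P by (simp add: regular_polygon_def)
  then have k2: "2 \<le> k" by simp
  obtain A where A: "finite A" "no3 A" "card A = N" "M \<le> card (polygons k A)"
    using exists_planar_projection[OF V(1,2) k2] V(3) MN(3) by auto
  \<comment> \<open>The numerator pays for the constant polygons, \<open>k\<^sup>2\<close> for the
    multiplicity of a copy, and \<open>M\<close> for rounding \<open>n\<close> up to the next power
    of \<open>N\<close>.\<close>
  define \<kappa> where "\<kappa> = (1 - real N / real M) / (real k ^ 2 * real M)"
  have e: "real N powr e = real M" unfolding e_def using MN by (simp add: powr_def)
  have e0: "0 \<le> e" unfolding e_def using MN by simp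
  have "\<kappa> * real n powr e \<le> real (max_sim_count P n)" if n: "N \<le> n" for n
  proof -
    obtain j where j: "N ^ j \<le> n" "n < N ^ Suc j" using ex_power_ivl1[of N n] MN(1) n by auto
    have j1: "1 \<le> j" using j(2) n by (cases j) auto
    obtain Q where Q: "finite Q" "no3 Q" "card Q = N ^ j" "card (polygons k A) ^ j \<le> card (polygons k Q)"
      using exists_power_set[OF A(1,2) k2] A(3) by metis
    have "M ^ j \<le> card (polygons k Q)" using Q(4) power_mono[OF A(4)] by (meson le0 order_trans)
    also have "\<dots> \<le> N ^ j + k\<^sup>2 * sim_count P Q" using card_polygons_le_sim_count[OF Q(1) P] Q(3) by simp
    also have "\<dots> \<le> N ^ j + k\<^sup>2 * max_sim_count P n"
      using sim_count_le_max_sim_count[OF Q(1,2)] Q(3) j(1) by simp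
    finally have "real (M ^ j) \<le> real (N ^ j + k\<^sup>2 * max_sim_count P n)" by (simp only: of_nat_le_iff)
    then have 1: "real M ^ j - real N ^ j \<le> real k ^ 2 * real (max_sim_count P n)" by simp
    have "real N ^ j / real M ^ j = (real N / real M) ^ j" by (simp add: power_divide)
    \<comment> \<open>Here \<open>j \<ge> 1\<close> matters: for \<open>j = 0\<close> the constant
      polygons could be all there are.\<close>
    also have "\<dots> \<le> (real N / real M) ^ 1" by (rule power_decreasing) (use j1 MN in auto)
    finally have "real N ^ j \<le> real N / real M * real M ^ j" using MN by (simp add: field_simps)
    with 1 have 2: "(1 - real N / real M) * real M ^ j \<le> real k ^ 2 * real (max_sim_count P n)"
      by (simp add: algebra_simps)
    have "real n powr e \<le> (real N ^ Suc j) powr e"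
      by (rule powr_mono2) (use e0 j(2) in \<open>auto simp flip: of_nat_power of_nat_mult\<close>)
    also have "\<dots> = (real N powr real (Suc j)) powr e" using MN by (subst powr_realpow) auto
    also have "\<dots> = (real N powr e) powr real (Suc j)" by (simp only: powr_powr mult.commute)
    also have "\<dots> = real M ^ Suc j" unfolding e using MN by (intro powr_realpow) auto
    finally have 3: "real n powr e \<le> real M ^ Suc j" .
    have "\<kappa> * real n powr e \<le> \<kappa> * real M ^ Suc j"
      by (rule mult_left_mono[OF 3]) (use MN in \<open>simp add: \<kappa>_def\<close>)
    also have "\<dots> = (1 - real N / real M) * real M ^ j / real k ^ 2"
      using MN by (simp add: \<kappa>_def)
    also have "\<dots> \<le> real (max_sim_count P n)" using 2 k by (simp add: pos_divide_le_eq mult.commute)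
    finally show ?thesis .
  qed
  moreover have "0 < \<kappa>" using MN k by (simp add: \<kappa>_def)
  ultimately show ?thesis unfolding e_def[symmetric]
    by (intro landau_omega.bigI[of \<kappa>]) (auto intro!: eventually_sequentiallyI[of N])
qed

section \<open>Configurations on a sphere in \<open>\<complex>\<^sup>2\<close>\<close>

lemma finite_polygons2:
  assumes "finite V" "2 \<le> k"
  shows "finite (polygons2 k V)"
proof (rule finite_subset)
  show "polygons2 k V \<subseteq> polygons k (fst ` V) \<times> polygons k (snd ` V)"
    by (force simp: polygons2_def polygons_def)
  show "finite (polygons k (fst ` V) \<times> polygons k (snd ` V))"
    using assms finite_polygons by simp
qed

text \<open>The part of the count common to all configurations, which uses only invariance under
  turning each coordinate separately. Only the family \<open>F\<close>, turning in both coordinates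
  about nonzero centres, depends on the configuration.\<close>

lemma card_polygons2_ge:
  fixes A :: "(complex \<times> complex) set"
  assumes A: "finite A" "(0, 0) \<notin> A" and k: "2 \<le> k"
    and sym: "\<And>x y w. (x, y) \<in> A \<Longrightarrow> w ^ k = 1 \<Longrightarrow> (x * w, y) \<in> A \<and> (x, y * w) \<in> A"
    and F: "F \<subseteq> polygons2 k A" "\<And>c r d s. ((c, r), (d, s)) \<in> F \<Longrightarrow> c \<noteq> 0 \<and> r \<noteq> 0 \<and> d \<noteq> 0 \<and> s \<noteq> 0"
    and B: "B \<subseteq> A" "\<And>x y. (x, y) \<in> B \<Longrightarrow> x \<noteq> 0 \<and> y \<noteq> 0"
  shows "2 * card A + 2 * card B + card F \<le> card (polygons2 k A)"
proof -
  \<comment> \<open>Constant polygons, polygons centred at the origin, and polygons turning in one coordinate only;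
    they are told apart from each other and from \<open>F\<close> by the vanishing of coordinates.\<close>
  define F1 where "F1 = (\<lambda>(x, y). ((x, 0::complex), (y, 0::complex))) ` A"
  define F2 where "F2 = (\<lambda>(x, y). ((0::complex, x), (0::complex, y))) ` A"
  \<comment> \<open>Indexed by \<open>B\<close> only: with a zero coordinate these maps would
    already occur in \<open>F1\<close> or \<open>F2\<close>.\<close>
  define F3 where "F3 = (\<lambda>(x, y). ((x, 0::complex), (0::complex, y))) ` B"
  define F4 where "F4 = (\<lambda>(x, y). ((0::complex, x), (y, 0::complex))) ` B"
  have finB: "finite B" using A(1) B(1) finite_subset by blast
  have finF: "finite F" using F(1) finite_polygons2[OF A(1) k] finite_subset by blast
  have card: "card F1 = card A" "card F2 = card A" "card F3 = card B" "card F4 = card B"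
    unfolding F1_def F2_def F3_def F4_def by (intro card_image; auto simp: inj_on_def)+
  have sub: "F1 \<union> F2 \<union> F3 \<union> F4 \<union> F \<subseteq> polygons2 k A"
    using F(1) sym B(1) unfolding F1_def F2_def F3_def F4_def by (auto simp: polygons2_def)
  have "card (F1 \<union> F2 \<union> F3 \<union> F4 \<union> F) = card F1 + card F2 + card F3 + card F4 + card F"
  proof -
    have fin: "finite F1" "finite F2" "finite F3" "finite F4"
      using A(1) finB unfolding F1_def F2_def F3_def F4_def by auto
    have "F1 \<inter> F2 = {}" using A(2) unfolding F1_def F2_def by auto
    moreover have "(F1 \<union> F2) \<inter> F3 = {}" using B(2) unfolding F1_def F2_def F3_def by fastforce
    moreover have "(F1 \<union> F2 \<union> F3) \<inter> F4 = {}" using B(2) unfolding F1_def F2_def F3_def F4_def by fastforce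
    moreover have "(F1 \<union> F2 \<union> F3 \<union> F4) \<inter> F = {}" using F(2) unfolding F1_def F2_def F3_def F4_def by fastforce
    ultimately show ?thesis using fin finF by (simp add: card_Un_disjoint)
  qed
  then show ?thesis using card_mono[OF finite_polygons2[OF A(1) k] sub] card by simp
qed

section \<open>The configuration for even \<open>k\<close>\<close>

lemma cnj_root_of_unity: "w ^ k = 1 \<Longrightarrow> cnj w ^ k = 1"
  by (metis complex_cnj_one complex_cnj_power)

text \<open>Apart from 1 and -1, the roots come in conjugate pairs.\<close>

lemma card_roots_of_unity_upper_half_plane:
  assumes k: "k = 2 * t + 2"
  shows "card {w::complex. w ^ k = 1 \<and> Im w > 0} = t"
proof -
  define U where "U = {w::complex. w ^ k = 1}"
  define T where "T = {w \<in> U. Im w > 0}"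
  have cnjU: "cnj w \<in> U" if "w \<in> U" for w using that cnj_root_of_unity unfolding U_def by blast
  have fin: "finite U" unfolding U_def by (rule finite_roots_unity) (simp add: k)
  have "U = {1, -1} \<union> (T \<union> cnj ` T)"
  proof (intro equalityI subsetI)
    fix w assume w: "w \<in> U"
    then have "cmod w = 1" using power_eq_1_iff[of w k] by (simp add: U_def k)
    then have n: "(Re w)\<^sup>2 + (Im w)\<^sup>2 = 1" using cmod_power2[of w] by simp
    consider "Im w = 0" | "Im w > 0" | "Im w < 0" by linarith
    then show "w \<in> {1, -1} \<union> (T \<union> cnj ` T)"
    proof cases
      case 1 then show ?thesis using n by (auto simp: complex_eq_iff power2_eq_1_iff)
    next
      case 2 then show ?thesis using w by (simp add: T_def)
    next
      case 3
      then have "cnj w \<in> T" using w cnjU by (simp add: T_def)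
      then show ?thesis by (auto intro!: image_eqI[of w cnj "cnj w"])
    qed
  next
    fix w assume "w \<in> {1, -1} \<union> (T \<union> cnj ` T)"
    moreover have "1 \<in> U" "-1 \<in> U" using k by (simp_all add: U_def)
    ultimately show "w \<in> U" using cnjU by (auto simp: T_def)
  qed
  moreover have "{1, -1} \<inter> (T \<union> cnj ` T) = {}" by (auto simp: T_def complex_eq_iff)
  moreover have "T \<inter> cnj ` T = {}" by (auto simp: T_def)
  moreover have "finite T" using fin by (simp add: T_def)
  moreover have "card (cnj ` T) = card T" by (rule card_image) (auto simp: inj_on_def)
  ultimately have "card U = 2 + 2 * card T" by (simp add: card_Un_disjoint)
  moreover have "card U = k" unfolding U_def using k by (intro card_roots_unity_eq) simp
  ultimately have "card T = t" using k by simp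
  then show ?thesis by (simp add: T_def U_def)
qed

text \<open>The squared moduli of \<open>1 + w\<close> and \<open>1 - w\<close> add up to 4, so all
  points lie on the sphere of radius 2. The values \<open>w = 1\<close> and \<open>w = -1\<close>
  give the \<open>2 * k\<close> points on the axes. Conjugate values of \<open>w\<close> give the
  same points, so the upper half-plane accounts for the remaining
  \<open>k\<^sup>2 * t\<close>.\<close>

lemma even_configuration:
  fixes k t N :: nat
  assumes k: "k = 2 * t + 2" and N: "N = 2 * k + k\<^sup>2 * t"
  obtains A :: "(complex \<times> complex) set"
  where "finite A" "no3 A" "card A = N" "2 * N + 2 * (k\<^sup>2 * t) + k ^ 3 \<le> card (polygons2 k A)"
proof -
  define U where "U = {w::complex. w ^ k = 1}"
  define g where "g = (\<lambda>(x, y, w::complex). (x * (1 + w), y * (1 - w)))"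
  define A where "A = g ` (U \<times> U \<times> U)"
  define T where "T = {w \<in> U. Im w > 0}"
  define B where "B = g ` (U \<times> U \<times> T)"
  \<comment> \<open>With \<open>x\<close> and \<open>y\<close> fixed, the vertices are the points of
    \<open>A\<close> obtained by multiplying \<open>w\<close> by all roots of unity.\<close>
  define F where "F = (\<lambda>(x, y, w). ((x, x * w), (y, - y * w))) ` (U \<times> U \<times> U)"
  have k0: "2 \<le> k" "even k" using k by auto
  have U: "finite U" "card U = k" unfolding U_def using card_roots_unity_eq[of k] finite_roots_unity[of k] k by auto
  have T: "finite T" "card T = t" "T \<subseteq> U"
    using card_roots_of_unity_upper_half_plane[OF k] U(1) unfolding T_def U_def by auto
  have Uc: "x * y \<in> U" "- x \<in> U" "cnj x \<in> U" "x \<noteq> 0" "x * cnj x = 1" "cmod x = 1"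
    if "x \<in> U" "y \<in> U" for x y
  proof -
    show "x * y \<in> U" "- x \<in> U" using that k0(2) by (auto simp: U_def power_mult_distrib)
    show "x \<noteq> 0" using that k0(1) by (auto simp: U_def power_0_left)
    show n: "cmod x = 1" using that k0(1) power_eq_1_iff[of x k] by (simp add: U_def)
    then show "x * cnj x = 1" by (simp add: complex_norm_square[symmetric])
    show "cnj x \<in> U" using that cnj_root_of_unity by (simp add: U_def)
  qed
  have one: "1 \<in> U" by (simp add: U_def)
  have w2: "(cmod (1 + w))\<^sup>2 = 2 + 2 * Re w" "(cmod (1 - w))\<^sup>2 = 2 - 2 * Re w" if "w \<in> U" for w
  proof -
    have "(Re w)\<^sup>2 + (Im w)\<^sup>2 = 1" using Uc(6)[OF that that] cmod_power2[of w] by simp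
    then show "(cmod (1 + w))\<^sup>2 = 2 + 2 * Re w" "(cmod (1 - w))\<^sup>2 = 2 - 2 * Re w"
      unfolding cmod_power2 by (simp_all add: power2_eq_square algebra_simps)
  qed
  have finA: "finite A" unfolding A_def using U(1) by simp
  have norm: "norm v = 2" if "v \<in> A" for v
    using that unfolding A_def g_def
    by (auto simp: norm_Pair norm_mult power_mult_distrib Uc(6) w2)
  have nz: "1 + w \<noteq> 0" "1 - w \<noteq> 0" if "w \<in> T" for w
    using that by (auto simp: T_def add_eq_0_iff)
  have A_eq: "A = (\<lambda>x. (2 * x, 0)) ` U \<union> (\<lambda>y. (0, 2 * y)) ` U \<union> B"
  proof (intro equalityI subsetI)
    fix v assume "v \<in> A"
    then obtain x y w where v: "v = (x * (1 + w), y * (1 - w))" "x \<in> U" "y \<in> U" "w \<in> U"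
      by (auto simp: A_def g_def)
    consider "Im w = 0" | "Im w > 0" | "Im w < 0" by linarith
    then show "v \<in> (\<lambda>x. (2 * x, 0)) ` U \<union> (\<lambda>y. (0, 2 * y)) ` U \<union> B"
    proof cases
      case 1
      then have "w = 1 \<or> w = -1"
        using Uc(6)[OF v(4) v(4)] cmod_power2[of w] by (auto simp: complex_eq_iff power2_eq_1_iff)
      then show ?thesis using v by (auto simp: mult.commute)
    next
      case 2
      have "v = g (x, y, w)" using v by (simp add: g_def)
      then show ?thesis using v 2 unfolding B_def T_def by blast
    next
      case 3
      \<comment> \<open>As \<open>w * cnj w = 1\<close>, conjugating \<open>w\<close> is compensated
        by turning \<open>x\<close> and \<open>y\<close>. The sign stays inside \<open>U\<close>
        because \<open>k\<close> is even.\<close>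
      have "x * (1 + w) = (x * w) * (1 + cnj w)" "y * (1 - w) = (- (y * w)) * (1 - cnj w)"
        using Uc(5)[OF v(4) v(4)] by (simp_all add: algebra_simps)
      then have "v = g (x * w, - (y * w), cnj w)" using v(1) by (simp add: g_def)
      moreover have "(x * w, - (y * w), cnj w) \<in> U \<times> U \<times> T"
        using 3 v Uc one by (auto simp: T_def)
      ultimately show ?thesis unfolding B_def by blast
    qed
  next
    fix v assume "v \<in> (\<lambda>x. (2 * x, 0)) ` U \<union> (\<lambda>y. (0, 2 * y)) ` U \<union> B"
    then consider x where "x \<in> U" "v = g (x, 1, 1)" | y where "y \<in> U" "v = g (1, y, -1)" | "v \<in> B"
      by (auto simp: g_def)
    then show "v \<in> A"
      using T(3) one Uc(2)[OF one one] unfolding A_def B_def by cases auto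
  qed
  have cardB: "card B = k\<^sup>2 * t"
  proof -
    have "inj_on g (U \<times> U \<times> T)"
    proof (rule inj_onI, clarsimp)
      fix x y w x' y' w' assume m: "x \<in> U" "y \<in> U" "w \<in> T" "x' \<in> U" "y' \<in> U" "w' \<in> T"
        and eq: "g (x, y, w) = g (x', y', w')"
      then have wU: "w \<in> U" "w' \<in> U" using T(3) by auto
      \<comment> \<open>The modulus of the first coordinate determines \<open>Re w\<close>, and the
        upper half-plane then determines \<open>w\<close>.\<close>
      have "cmod (x * (1 + w)) = cmod (x' * (1 + w'))" using eq by (simp add: g_def)
      then have "cmod (1 + w) = cmod (1 + w')" using Uc(6) m by (simp add: norm_mult)
      then have re: "Re w = Re w'" using w2 wU by (metis add_left_cancel mult_left_cancel zero_neq_numeral)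
      then have "(Im w)\<^sup>2 = (Im w')\<^sup>2"
        using Uc(6)[OF wU(1) wU(1)] Uc(6)[OF wU(2) wU(2)] cmod_power2[of w] cmod_power2[of w'] by simp
      then have "w = w'" using re m by (auto simp: T_def complex_eq_iff power2_eq_iff)
      then show "x = x' \<and> y = y' \<and> w = w'" using eq nz m by (auto simp: g_def)
    qed
    then show ?thesis unfolding B_def
      by (simp add: card_image card_cartesian_product U T power2_eq_square)
  qed
  have B: "B \<subseteq> A" "\<And>x y. (x, y) \<in> B \<Longrightarrow> x \<noteq> 0 \<and> y \<noteq> 0"
    using A_eq nz Uc(4) by (auto simp: B_def g_def)
  have cardA: "card A = N"
  proof -
    have "card ((\<lambda>x. (2 * x, 0::complex)) ` U) = card U" "card ((\<lambda>y. (0::complex, 2 * y)) ` U) = card U"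
      by (auto intro!: card_image simp: inj_on_def)
    moreover have "(\<lambda>x. (2 * x, 0)) ` U \<inter> (\<lambda>y. (0, 2 * y)) ` U = {}"
      using Uc(4) by auto
    moreover have "((\<lambda>x. (2 * x, 0)) ` U \<union> (\<lambda>y. (0, 2 * y)) ` U) \<inter> B = {}"
      using B(2) by auto
    moreover have "finite B" using B(1) finA finite_subset by blast
    ultimately show ?thesis unfolding A_eq using U cardB by (simp add: card_Un_disjoint N)
  qed
  have "2 * card A + 2 * card B + card F \<le> card (polygons2 k A)"
  proof (rule card_polygons2_ge[OF finA _ k0(1) _ _ _ B])
    show "(0, 0) \<notin> A" using norm[of "(0, 0)"] by auto
    show "(x * w, y) \<in> A \<and> (x, y * w) \<in> A" if xy: "(x, y) \<in> A" and "w ^ k = 1" for x y w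
    proof -
      obtain a b z where abz: "x = a * (1 + z)" "y = b * (1 - z)" "a \<in> U" "b \<in> U" "z \<in> U"
        using xy by (auto simp: A_def g_def)
      have w: "w \<in> U" using that(2) by (simp add: U_def)
      have "(x * w, y) = g (a * w, b, z)" "(x, y * w) = g (a, b * w, z)" using abz by (simp_all add: g_def)
      then show ?thesis using abz w Uc(1) unfolding A_def by blast
    qed
    show "F \<subseteq> polygons2 k A"
    proof (clarsimp simp: F_def polygons2_def)
      fix x y w z assume m: "x \<in> U" "y \<in> U" "w \<in> U" "z ^ k = (1::complex)"
      then have "w * z \<in> U" using Uc(1) by (simp add: U_def)
      moreover have "(x + x * w * z, y - y * w * z) = g (x, y, w * z)" by (simp add: g_def algebra_simps)
      ultimately show "(x + x * w * z, y - y * w * z) \<in> A" using m unfolding A_def by blast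
    qed
    show "c \<noteq> 0 \<and> r \<noteq> 0 \<and> d \<noteq> 0 \<and> s \<noteq> 0" if "((c, r), (d, s)) \<in> F" for c r d s
      using that Uc(4) by (auto simp: F_def)
  qed
  moreover have "card F = k ^ 3"
    unfolding F_def using Uc(4)
    by (subst card_image) (auto simp: inj_on_def card_cartesian_product U power3_eq_cube)
  ultimately show thesis using that[OF finA no3_sphere[OF norm] cardA] cardA cardB by simp
qed

section \<open>The configuration for the pentagon\<close>

text \<open>There are 20 points on the axes and two orbits of 50 points off them. Four families of
  250 pentagons turn in both coordinates, and
  \<open>2 * 120 + 2 * 100 + 1000 = 1440\<close>.\<close>

lemma pentagon_configuration:
  obtains A :: "(complex \<times> complex) set"
  where "finite A" "no3 A" "card A = 120" "1440 \<le> card (polygons2 5 A)"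
proof -
  obtain z :: complex where z5: "z ^ 5 = 1" and z1: "z \<noteq> 1"
    using exists_root_of_unity_neq_1[of 5] by auto
  \<comment> \<open>The golden ratio (for a suitable choice of \<open>z\<close>), its inverse, and \<open>sqrt 5\<close>.\<close>
  define \<phi> where "\<phi> = - (z ^ 2 + z ^ 3)"
  define \<psi> where "\<psi> = z + z ^ 4"
  define \<delta> where "\<delta> = \<phi> + \<psi>"
  define u where "u = 1 - z ^ 2"
  define v where "v = 1 - z"
  define U where "U = {w::complex. w ^ 5 = 1}"
  define W where "W = {w::complex. w ^ 10 = 1}"
  \<comment> \<open>Orbits of \<open>(u, - v)\<close> and \<open>(v, u)\<close> under the maps that
    multiply the coordinates by \<open>x\<close> and \<open>x * m\<close>, with \<open>x\<close> in
    \<open>W\<close> and \<open>m\<close> in \<open>U\<close>.\<close>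
  define g1 where "g1 = (\<lambda>(x, m). (u * x, - (v * x * m)))"
  define g2 where "g2 = (\<lambda>(x, m). (v * x, u * x * m))"
  define B where "B = g1 ` (W \<times> U) \<union> g2 ` (W \<times> U)"
  define A where "A = (\<lambda>x. (\<delta> * x, 0)) ` W \<union> (\<lambda>x. (0, \<delta> * x)) ` W \<union> B"
  \<comment> \<open>The pentagons turning in both coordinates form four orbits under the symmetries
    \<open>(a, b) \<mapsto> (a * x, b * x * m)\<close>; \<open>rot\<close> below exchanges the orbits in pairs.\<close>
  define fam where "fam = (\<lambda>c r d s. (\<lambda>(x, m, w). ((c * x, r * x * w), (d * x * m, s * x * m * w))) ` (W \<times> U \<times> U))"
  define F where "F = fam \<phi> \<psi> 1 (-1) \<union> fam (-1) 1 \<phi> \<psi> \<union> fam \<psi> \<phi> (-1) 1 \<union> fam 1 (-1) \<psi> \<phi>"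

  have "(z - 1) * (1 + z + z ^ 2 + z ^ 3 + z ^ 4) = z ^ 5 - 1" by algebra
  then have zs: "1 + z + z ^ 2 + z ^ 3 + z ^ 4 = 0" using z5 z1 by simp
  have cnj_z: "cnj z = z ^ 4"
  proof -
    have "cmod z = 1" using z5 power_eq_1_iff[of z 5] by simp
    then have "cnj z * z = 1" using complex_norm_square[of z] by (simp add: mult.commute)
    moreover have "z ^ 4 * z = 1" using z5 by algebra
    ultimately show ?thesis using \<open>z ^ 4 * z = 1\<close> by (metis mult_right_cancel mult_zero_right zero_neq_one)
  qed
  have pp: "\<phi> * \<psi> = 1" "\<phi> = \<psi> + 1" unfolding \<phi>_def \<psi>_def using zs by algebra+
  have dd: "\<delta> ^ 2 = 5" unfolding \<delta>_def using pp by algebra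
  have cnj_pp: "cnj \<phi> = \<phi>" "cnj \<psi> = \<psi>" "cnj \<delta> = \<delta>"
    unfolding \<delta>_def \<phi>_def \<psi>_def by (simp_all add: cnj_z) (use z5 in algebra)+
  \<comment> \<open>The first identity puts \<open>B\<close> on the sphere of the axis points, as
    \<delta> has square 5; the second separates the moduli of \<open>u\<close> and \<open>v\<close>,
    hence the two orbits.\<close>
  have uv: "u * cnj u + v * cnj v = 5" "u * cnj u - v * cnj v = \<delta>"
    unfolding u_def v_def \<delta>_def \<phi>_def \<psi>_def by (simp_all add: cnj_z) (use zs in algebra)+
  have nz: "\<phi> \<noteq> 0" "\<psi> \<noteq> 0" "\<delta> \<noteq> 0" using pp dd by auto
  have "z ^ 2 \<noteq> 1"
  proof
    assume "z ^ 2 = 1"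
    then have "z = 1" using z5 by algebra
    then show False using z1 by blast
  qed
  then have unz: "u \<noteq> 0" "v \<noteq> 0" using z1 unfolding u_def v_def by auto

  have fin: "finite U" "finite W" unfolding U_def W_def by (rule finite_roots_unity; simp)+
  have card: "card U = 5" "card W = 10" unfolding U_def W_def by (simp_all add: card_roots_unity_eq)
  have W0: "x \<noteq> 0" if "x \<in> W" for x using that by (auto simp: W_def)
  have U0: "x \<noteq> 0" if "x \<in> U" for x using that by (auto simp: U_def)
  have UW: "x \<in> W" if "x \<in> U" for x
  proof -
    have "x ^ 10 = (x ^ 5) ^ 2" by simp
    also have "\<dots> = 1" using that by (simp only: U_def mem_Collect_eq power_one)
    finally show ?thesis by (simp add: W_def)
  qed
  have mult: "x * y \<in> W" if "x \<in> W" "y \<in> W" for x y using that by (simp add: W_def power_mult_distrib)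
  have multU: "x * y \<in> U" if "x \<in> U" "y \<in> U" for x y using that by (simp add: U_def power_mult_distrib)
  have invU: "x ^ 4 \<in> U" "x * x ^ 4 = 1" if "x \<in> U" for x
  proof -
    show 1: "x * x ^ 4 = 1" using that unfolding U_def by (simp add: power_Suc[symmetric])
    have "(x ^ 4) ^ 5 = (x ^ 5) ^ 4" by simp
    also have "\<dots> = 1" using that by (simp only: U_def mem_Collect_eq power_one)
    finally show "x ^ 4 \<in> U" by (simp add: U_def)
  qed
  have minus: "- x \<in> W" if "x \<in> W" for x using that by (simp add: W_def)
  have cmodW: "cmod x = 1" if "x \<in> W" for x using that power_eq_1_iff[of x 10] by (simp add: W_def)
  have cmodU: "cmod x = 1" if "x \<in> U" for x using that UW cmodW by blast
  have zU: "z ^ i \<in> U" for i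
    using z5 by (simp add: U_def) (metis mult.commute power_mult power_one)

  have one_z: "1 \<in> U" "z \<in> U" using z5 by (simp_all add: U_def)

  have norms: "(cmod u)\<^sup>2 + (cmod v)\<^sup>2 = 5" "(cmod \<delta>)\<^sup>2 = 5" "cmod u \<noteq> cmod v"
    "cmod \<phi> \<noteq> cmod \<psi>" "cmod \<phi> \<noteq> 1" "cmod \<psi> \<noteq> 1"
  proof -
    have "complex_of_real ((cmod u)\<^sup>2 + (cmod v)\<^sup>2) = of_real 5" "complex_of_real ((cmod \<delta>)\<^sup>2) = of_real 5"
      unfolding of_real_add complex_norm_square using uv dd cnj_pp by (simp_all add: power2_eq_square)
    then show "(cmod u)\<^sup>2 + (cmod v)\<^sup>2 = 5" "(cmod \<delta>)\<^sup>2 = 5" by (simp_all only: of_real_eq_iff)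
    \<comment> \<open>Comparing moduli becomes algebra, since conjugation is known explicitly; no
      numerical value of \<open>z\<close> is involved.\<close>
    have sq: "a * cnj a = b * cnj b" if "cmod a = cmod b" for a b
      using that by (simp flip: complex_norm_square)
    show "cmod u \<noteq> cmod v" using sq[of u v] uv(2) nz(3) by auto
    have "\<phi> * \<phi> \<noteq> \<psi> * \<psi>"
    proof
      assume "\<phi> * \<phi> = \<psi> * \<psi>"
      then have "(5::complex) = 0" using pp by algebra
      then show False by simp
    qed
    then show "cmod \<phi> \<noteq> cmod \<psi>" using sq[of \<phi> \<psi>] cnj_pp by auto
    have "\<phi> * \<phi> \<noteq> 1" "\<psi> * \<psi> \<noteq> 1"
    proof -
      have "\<phi> * \<phi> = 1 + \<phi>" "\<psi> * \<psi> = 1 - \<psi>" using pp by algebra+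
      then show "\<phi> * \<phi> \<noteq> 1" "\<psi> * \<psi> \<noteq> 1" using nz by auto
    qed
    then show "cmod \<phi> \<noteq> 1" "cmod \<psi> \<noteq> 1" using sq[of \<phi> 1] sq[of \<psi> 1] cnj_pp by auto
  qed
  have finA: "finite A" unfolding A_def B_def using fin by simp
  have norm: "norm a = sqrt 5" if "a \<in> A" for a
    using that norms(1,2) unfolding A_def B_def g1_def g2_def
    by (auto simp: norm_Pair norm_mult power_mult_distrib cmodW cmodU add.commute)
  have B: "B \<subseteq> A" "\<And>x y. (x, y) \<in> B \<Longrightarrow> x \<noteq> 0 \<and> y \<noteq> 0"
    using unz W0 U0 by (auto simp: A_def B_def g1_def g2_def)
  have cardB: "card B = 100"
  proof -
    have "inj_on g1 (W \<times> U)" "inj_on g2 (W \<times> U)"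
      using unz W0 by (auto simp: inj_on_def g1_def g2_def)
    then have "card (g1 ` (W \<times> U)) = 50" "card (g2 ` (W \<times> U)) = 50"
      by (simp_all add: card_image card_cartesian_product card)
    moreover have "g1 ` (W \<times> U) \<inter> g2 ` (W \<times> U) = {}"
    proof -
      have "cmod (fst p) = cmod u" if "p \<in> g1 ` (W \<times> U)" for p
        using that by (auto simp: g1_def norm_mult cmodW)
      moreover have "cmod (fst p) = cmod v" if "p \<in> g2 ` (W \<times> U)" for p
        using that by (auto simp: g2_def norm_mult cmodW)
      ultimately show ?thesis using norms(3) by force
    qed
    ultimately show ?thesis unfolding B_def using fin by (simp add: card_Un_disjoint)
  qed
  have cardA: "card A = 120"
  proof -
    have "card ((\<lambda>x. (\<delta> * x, 0::complex)) ` W) = card W" "card ((\<lambda>x. (0::complex, \<delta> * x)) ` W) = card W"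
      using nz by (auto intro!: card_image simp: inj_on_def)
    moreover have "(\<lambda>x. (\<delta> * x, 0)) ` W \<inter> (\<lambda>x. (0, \<delta> * x)) ` W = {}"
      using W0 nz by auto
    moreover have "((\<lambda>x. (\<delta> * x, 0)) ` W \<union> (\<lambda>x. (0, \<delta> * x)) ` W) \<inter> B = {}"
      using B(2) by auto
    moreover have "finite B" using B(1) finA finite_subset by blast
    ultimately show ?thesis unfolding A_def using fin card cardB by (simp add: card_Un_disjoint)
  qed

  have A_intros: "(\<delta> * x, 0) \<in> A" "(0, \<delta> * x) \<in> A" if "x \<in> W" for x
    using that unfolding A_def by auto
  have g_intros: "g1 (x, m) \<in> A" "g2 (x, m) \<in> A" if "x \<in> W" "m \<in> U" for x m
    using that unfolding A_def B_def by auto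
  have torus: "(a * x, b * x * m) \<in> A" if ab: "(a, b) \<in> A" and "x \<in> W" "m \<in> U" for a b x m
  proof -
    consider y where "y \<in> W" "(a, b) = (\<delta> * y, 0)" | y where "y \<in> W" "(a, b) = (0, \<delta> * y)"
      | y n where "y \<in> W" "n \<in> U" "(a, b) = g1 (y, n)" | y n where "y \<in> W" "n \<in> U" "(a, b) = g2 (y, n)"
      using ab unfolding A_def B_def by blast
    then show ?thesis
    proof cases
      case 1
      then show ?thesis using A_intros(1)[of "y * x"] that mult by (simp add: mult.assoc)
    next
      case 2
      then show ?thesis using A_intros(2)[of "y * x * m"] that mult UW by (simp add: mult.assoc)
    next
      case 3
      then show ?thesis using g_intros(1)[of "y * x" "n * m"] that mult multU
        by (simp add: g1_def mult_ac)
    next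
      case 4
      then show ?thesis using g_intros(2)[of "y * x" "n * m"] that mult multU
        by (simp add: g2_def mult_ac)
    qed
  qed
  have rot: "(- b, a) \<in> A" if ab: "(a, b) \<in> A" for a b
  proof -
    consider y where "y \<in> W" "(a, b) = (\<delta> * y, 0)" | y where "y \<in> W" "(a, b) = (0, \<delta> * y)"
      | y n where "y \<in> W" "n \<in> U" "(a, b) = g1 (y, n)" | y n where "y \<in> W" "n \<in> U" "(a, b) = g2 (y, n)"
      using ab unfolding A_def B_def by blast
    then show ?thesis
    proof cases
      case 1
      then show ?thesis using A_intros(2)[of y] by simp
    next
      case 2
      then show ?thesis using A_intros(1)[of "- y"] minus by simp
    next
      case 3
      \<comment> \<open>The inverse of \<open>n\<close> is \<open>n ^ 4\<close>: the factor
        \<open>n\<close> moves from the second coordinate to the first.\<close>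
      then have "(- b, a) = g2 (y * n, n ^ 4)" using invU(2)[of n] by (simp add: g1_def g2_def mult.assoc)
      then show ?thesis using g_intros(2)[of "y * n" "n ^ 4"] 3 mult UW invU by simp
    next
      case 4
      then have "(- b, a) = g1 (- (y * n), n ^ 4)" using invU(2)[of n] by (simp add: g1_def g2_def mult.assoc)
      then show ?thesis using g_intros(1)[of "- (y * n)" "n ^ 4"] 4 mult UW invU minus by simp
    qed
  qed
  have U_cases: "w = 1 \<or> w = z \<or> w = z ^ 2 \<or> w = z ^ 3 \<or> w = z ^ 4" if "w \<in> U" for w
  proof -
    have "w ^ 5 = 1" using that by (simp add: U_def)
    then have "(w - 1) * (w - z) * (w - z ^ 2) * (w - z ^ 3) * (w - z ^ 4) = 0"
      using zs by algebra
    then show ?thesis by simp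
  qed
  \<comment> \<open>A model pentagon with centre \<open>(\<phi>, 1)\<close> and radius
    \<open>(\<psi>, -1)\<close>. Its vertex at \<open>w = 1\<close> lies on an axis; the other four
    are located in the two orbits.\<close>
  have P1: "(\<phi> + \<psi> * w, 1 - w) \<in> A" if w: "w \<in> U" for w
  proof -
    have "(\<phi> + \<psi> * 1, 1 - 1) \<in> A" using A_intros(1)[of 1] by (simp add: \<delta>_def W_def)
    moreover have "(\<phi> + \<psi> * z, 1 - z) = g1 (- (z ^ 3), z ^ 2)"
      unfolding g1_def g2_def prod.case prod.inject \<phi>_def \<psi>_def u_def v_def
      using zs by (intro conjI) (algebra | simp)+
    moreover have "(\<phi> + \<psi> * z ^ 2, 1 - z ^ 2) = g2 (z, z ^ 4)"
      unfolding g1_def g2_def prod.case prod.inject \<phi>_def \<psi>_def u_def v_def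
      using zs by (intro conjI) (algebra | simp)+
    moreover have "(\<phi> + \<psi> * z ^ 3, 1 - z ^ 3) = g2 (- (z ^ 3), 1)"
      unfolding g1_def g2_def prod.case prod.inject \<phi>_def \<psi>_def u_def v_def
      using zs by (intro conjI) (algebra | simp)+
    moreover have "(\<phi> + \<psi> * z ^ 4, 1 - z ^ 4) = g1 (1, z ^ 4)"
      unfolding g1_def g2_def prod.case prod.inject \<phi>_def \<psi>_def u_def v_def
      using zs by (intro conjI) (algebra | simp)+
    moreover have "g1 (x, m) \<in> A" "g2 (x, m) \<in> A" "g1 (- x, m) \<in> A" "g2 (- x, m) \<in> A"
      if "x \<in> U" "m \<in> U" for x m using that g_intros UW minus by auto
    ultimately show ?thesis using U_cases[OF w] zU one_z by metis
  qed
  \<comment> \<open>Centre and radius of the first model pentagon are exchanged.\<close>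
  have P2: "(\<psi> + \<phi> * w, w - 1) \<in> A" if w: "w \<in> U" for w
  proof -
    have "(\<psi> + \<phi> * 1, 1 - 1) \<in> A" using A_intros(1)[of 1] by (simp add: add.commute \<delta>_def W_def)
    moreover have "(\<psi> + \<phi> * z, z - 1) = g1 (z, z ^ 4)"
      unfolding g1_def g2_def prod.case prod.inject \<phi>_def \<psi>_def u_def v_def
      using zs by (intro conjI) (algebra | simp)+
    moreover have "(\<psi> + \<phi> * z ^ 2, z ^ 2 - 1) = g2 (- 1, 1)"
      unfolding g1_def g2_def prod.case prod.inject \<phi>_def \<psi>_def u_def v_def
      using zs by (intro conjI) (algebra | simp)+
    moreover have "(\<psi> + \<phi> * z ^ 3, z ^ 3 - 1) = g2 (z ^ 4, z ^ 4)"
      unfolding g1_def g2_def prod.case prod.inject \<phi>_def \<psi>_def u_def v_def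
      using zs by (intro conjI) (algebra | simp)+
    moreover have "(\<psi> + \<phi> * z ^ 4, z ^ 4 - 1) = g1 (- (z ^ 2), z ^ 2)"
      unfolding g1_def g2_def prod.case prod.inject \<phi>_def \<psi>_def u_def v_def
      using zs by (intro conjI) (algebra | simp)+
    moreover have "g1 (x, m) \<in> A" "g2 (x, m) \<in> A" "g1 (- x, m) \<in> A" "g2 (- x, m) \<in> A"
      if "x \<in> U" "m \<in> U" for x m using that g_intros UW minus by auto
    ultimately show ?thesis using U_cases[OF w] zU one_z by metis
  qed
  \<comment> \<open>The parameter \<open>w\<close> only changes the first vertex, while
    \<open>x\<close> and \<open>m\<close> act by \<open>torus\<close>.\<close>
  have fam_polygons: "fam c r d s \<subseteq> polygons2 5 A"
    if "\<And>w. w \<in> U \<Longrightarrow> (c + r * w, d + s * w) \<in> A" for c r d s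
  proof (clarsimp simp: fam_def polygons2_def)
    fix x m w t assume m: "x \<in> W" "m \<in> U" "w \<in> U" "t ^ 5 = (1::complex)"
    then have "w * t \<in> U" using multU by (simp add: U_def)
    from torus[OF that[OF this] m(1,2)]
    show "(c * x + r * x * w * t, d * x * m + s * x * m * w * t) \<in> A" by (simp add: algebra_simps)
  qed
  have fam_nz: "c' \<noteq> 0 \<and> r' \<noteq> 0 \<and> d' \<noteq> 0 \<and> s' \<noteq> 0"
    if "((c', r'), (d', s')) \<in> fam c r d s" "c \<noteq> 0" "r \<noteq> 0" "d \<noteq> 0" "s \<noteq> 0" for c r d s c' r' d' s'
    using that W0 U0 by (auto simp: fam_def)
  have fam_card: "card (fam c r d s) = 250" if "c \<noteq> 0" "r \<noteq> 0" "d \<noteq> 0" for c r d s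
    unfolding fam_def using that W0
    by (subst card_image) (auto simp: inj_on_def card_cartesian_product card)
  \<comment> \<open>The moduli of the two centre coordinates separate the families: up to modulus
    they are \<open>(\<phi>, 1)\<close>, \<open>(1, \<phi>)\<close>, \<open>(\<psi>, 1)\<close> and
    \<open>(1, \<psi>)\<close>.\<close>
  have fam_norm: "cmod (fst (fst p)) = cmod c \<and> cmod (fst (snd p)) = cmod d" if "p \<in> fam c r d s" for p c r d s
    using that by (auto simp: fam_def norm_mult cmodW cmodU)
  have fam_disj: "fam c r d s \<inter> fam c' r' d' s' = {}" if "cmod c \<noteq> cmod c' \<or> cmod d \<noteq> cmod d'" for c r d s c' r' d' s'
  proof (rule equals0I)
    fix p assume "p \<in> fam c r d s \<inter> fam c' r' d' s'"
    then show False using fam_norm[of p c r d s] fam_norm[of p c' r' d' s'] that by simp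
  qed
  have "card F = 1000"
  proof -
    have fin: "finite (fam c r d s)" for c r d s unfolding fam_def using fin by simp
    have "(fam \<phi> \<psi> 1 (-1) \<inter> fam (-1) 1 \<phi> \<psi>) = {}"
      "(fam \<phi> \<psi> 1 (-1) \<union> fam (-1) 1 \<phi> \<psi>) \<inter> fam \<psi> \<phi> (-1) 1 = {}"
      "(fam \<phi> \<psi> 1 (-1) \<union> fam (-1) 1 \<phi> \<psi> \<union> fam \<psi> \<phi> (-1) 1) \<inter> fam 1 (-1) \<psi> \<phi> = {}"
      unfolding Int_Un_distrib2 using norms(4-6) by (simp_all add: fam_disj)
    then show ?thesis unfolding F_def using nz by (simp add: card_Un_disjoint fin fam_card)
  qed
  moreover have "2 * card A + 2 * card B + card F \<le> card (polygons2 5 A)"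
  proof (rule card_polygons2_ge[OF finA _ _ _ _ _ B])
    show "(0, 0) \<notin> A" using norm[of "(0, 0)"] by auto
    show "(x * w, y) \<in> A \<and> (x, y * w) \<in> A" if "(x, y) \<in> A" "w ^ 5 = 1" for x y w
    proof -
      have w: "w \<in> U" using that(2) by (simp add: U_def)
      show ?thesis
        \<comment> \<open>The factors \<open>w\<close> and \<open>w ^ 4\<close> cancel in the second
          coordinate, so the first turns alone; the choice \<open>x = 1\<close>,
          \<open>m = w\<close> turns only the second.\<close>
        using torus[OF that(1), of w "w ^ 4"] torus[OF that(1), of 1 w] UW[OF w] w invU[OF w]
        by (simp add: mult.assoc W_def)
    qed
    \<comment> \<open>Applying \<open>rot\<close> to the two model pentagons yields the remaining
      two families.\<close>
    have "(- 1 + 1 * w, \<phi> + \<psi> * w) \<in> A" "(1 + -1 * w, \<psi> + \<phi> * w) \<in> A" if "w \<in> U" for w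
      using rot[OF P1[OF that]] rot[OF P2[OF that]] by simp_all
    then show "F \<subseteq> polygons2 5 A" unfolding F_def
      using P1 P2 by (intro Un_least fam_polygons) (simp_all add: algebra_simps)
    show "c \<noteq> 0 \<and> r \<noteq> 0 \<and> d \<noteq> 0 \<and> s \<noteq> 0" if "((c, r), (d, s)) \<in> F" for c r d s
      using that fam_nz[of c r d s \<phi> \<psi> 1 "-1"] fam_nz[of c r d s "-1" 1 \<phi> \<psi>]
        fam_nz[of c r d s \<psi> \<phi> "-1" 1] fam_nz[of c r d s 1 "-1" \<psi> \<phi>] nz
      unfolding F_def by (elim UnE) simp_all
  qed simp
  ultimately show thesis using that[OF finA no3_sphere[OF norm] cardA] cardA cardB by simp
qed

section \<open>The lower bounds\<close>

text \<open>Taking the common factor \<open>g\<close> out of \<open>(g * a) ^ p \<le> (g * b) ^ q\<close> keeps the numerals small.\<close>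

lemma powr_ln_ratio_bigomega:
  fixes a b g p q :: nat
  assumes le: "g ^ (p - q) * a ^ p \<le> b ^ q" and pos: "1 < g * a" "0 < b" "0 < q" "q \<le> p"
    and c: "c \<le> real p / real q"
  shows "(\<lambda>n::nat. real n powr (ln (real (g * b)) / ln (real (g * a)))) \<in> \<Omega>(\<lambda>n. real n powr c)"
proof -
  define M N where "M = g * b" and "N = g * a"
  have MN: "1 < N" "0 < M" using pos unfolding M_def N_def by (cases "g = 0"; simp)+
  have "N ^ p = g ^ q * (g ^ (p - q) * a ^ p)"
    unfolding N_def power_mult_distrib using pos(4) by (simp flip: power_add)
  also have "\<dots> \<le> g ^ q * b ^ q" using le by simp
  also have "\<dots> = M ^ q" unfolding M_def power_mult_distrib ..
  finally have "real N ^ p \<le> real M ^ q" by (metis of_nat_le_iff of_nat_power)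
  then have "ln (real N ^ p) \<le> ln (real M ^ q)" using MN by (intro ln_mono) auto
  then have "real p * ln (real N) \<le> real q * ln (real M)" using MN by (simp add: ln_realpow)
  then have "real p / real q \<le> ln (real M) / ln (real N)" using MN pos by (simp add: field_simps)
  with c have "c \<le> ln (real M) / ln (real N)" by linarith
  then show ?thesis unfolding M_def[symmetric] N_def[symmetric]
    by (intro landau_omega.bigI[of 1]) (auto intro!: eventually_sequentiallyI[of 1] powr_mono)
qed

lemma even_polygon_bigomega:
  fixes k t M N :: nat
  assumes P: "regular_polygon k P" and k: "k = 2 * t + 2"
    and N: "N = 2 * k + k\<^sup>2 * t" and M: "M = 2 * N + 2 * (k\<^sup>2 * t) + k ^ 3"
  shows "(\<lambda>n. real (max_sim_count P n)) \<in> \<Omega>(\<lambda>n. real n powr (ln (real M) / ln (real N)))"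
proof -
  obtain A where A: "finite A" "no3 A" "card A = N" "M \<le> card (polygons2 k A)"
    using even_configuration[OF k N] M by blast
  show ?thesis by (rule max_sim_count_bigomega[OF A(1-3) _ _ A(4) P]) (use k N M in auto)
qed

lemma pentagon_bigomega:
  assumes P: "regular_polygon 5 P"
  shows "(\<lambda>n. real (max_sim_count P n)) \<in> \<Omega>(\<lambda>n. real n powr (ln 1440 / ln 120))"
proof -
  obtain A where "finite A" "no3 A" "card A = 120" "1440 \<le> card (polygons2 5 A)"
    by (rule pentagon_configuration)
  from max_sim_count_bigomega[OF this(1-3) _ _ this(4) P] show ?thesis by simp
qed

theorem theorem4:
  fixes R :: "nat \<Rightarrow> complex set"
  assumes "\<And>k. k \<ge> 3 \<Longrightarrow> regular_polygon k (R k)"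
  shows "(\<lambda>n. real (max_sim_count (R 4) n)) \<in> \<Omega>(\<lambda>n::nat. real n powr (ln 144 / ln 24)) \<and>
    (\<lambda>n::nat. real n powr (ln 144 / ln 24)) \<in> \<Omega>(\<lambda>n. real n powr 1.563) \<and>
    (\<lambda>n. real (max_sim_count (R 6) n)) \<in> \<Omega>(\<lambda>n::nat. real n powr (ln 528 / ln 84)) \<and>
    (\<lambda>n::nat. real n powr (ln 528 / ln 84)) \<in> \<Omega>(\<lambda>n. real n powr 1.414) \<and>
    (\<lambda>n. real (max_sim_count (R 8) n)) \<in> \<Omega>(\<lambda>n::nat. real n powr (ln 1312 / ln 208)) \<and>
    (\<lambda>n::nat. real n powr (ln 1312 / ln 208)) \<in> \<Omega>(\<lambda>n. real n powr 1.345) \<and>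
    (\<lambda>n. real (max_sim_count (R 10) n)) \<in> \<Omega>(\<lambda>n::nat. real n powr (ln 2640 / ln 420)) \<and>
    (\<lambda>n::nat. real n powr (ln 2640 / ln 420)) \<in> \<Omega>(\<lambda>n. real n powr 1.304) \<and>
    (\<lambda>n. real (max_sim_count (R 5) n)) \<in> \<Omega>(\<lambda>n::nat. real n powr (ln 1440 / ln 120)) \<and>
    (\<lambda>n::nat. real n powr (ln 1440 / ln 120)) \<in> \<Omega>(\<lambda>n. real n powr 1.519)"
proof (intro conjI)
  have R: "regular_polygon 4 (R 4)" "regular_polygon 6 (R 6)" "regular_polygon 8 (R 8)"
    "regular_polygon 10 (R 10)" "regular_polygon 5 (R 5)"
    by (rule assms, simp)+
  show "(\<lambda>n. real (max_sim_count (R 4) n)) \<in> \<Omega>(\<lambda>n::nat. real n powr (ln 144 / ln 24))"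
    using even_polygon_bigomega[OF R(1), of 1 24 144] by simp
  show "(\<lambda>n. real (max_sim_count (R 6) n)) \<in> \<Omega>(\<lambda>n::nat. real n powr (ln 528 / ln 84))"
    using even_polygon_bigomega[OF R(2), of 2 84 528] by simp
  show "(\<lambda>n. real (max_sim_count (R 8) n)) \<in> \<Omega>(\<lambda>n::nat. real n powr (ln 1312 / ln 208))"
    using even_polygon_bigomega[OF R(3), of 3 208 1312] by simp
  show "(\<lambda>n. real (max_sim_count (R 10) n)) \<in> \<Omega>(\<lambda>n::nat. real n powr (ln 2640 / ln 420))"
    using even_polygon_bigomega[OF R(4), of 4 420 2640] by simp
  show "(\<lambda>n. real (max_sim_count (R 5) n)) \<in> \<Omega>(\<lambda>n::nat. real n powr (ln 1440 / ln 120))"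
    using pentagon_bigomega[OF R(5)] .
  \<comment> \<open>Here and below, \<open>p / q\<close> is a fraction between the decimal exponent
    and the ratio of logarithms (86/55 in this case), which leaves an inequality between
    integers.\<close>
  show "(\<lambda>n::nat. real n powr (ln 144 / ln 24)) \<in> \<Omega>(\<lambda>n. real n powr 1.563)"
    using powr_ln_ratio_bigomega[of 24 86 55 1 6 "1.563"] by simp
  show "(\<lambda>n::nat. real n powr (ln 528 / ln 84)) \<in> \<Omega>(\<lambda>n. real n powr 1.414)"
    using powr_ln_ratio_bigomega[of 12 58 41 7 44 "1.414"] by simp
  show "(\<lambda>n::nat. real n powr (ln 1312 / ln 208)) \<in> \<Omega>(\<lambda>n. real n powr 1.345)"
    using powr_ln_ratio_bigomega[of 16 230 171 13 82 "1.345"] by simp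
  show "(\<lambda>n::nat. real n powr (ln 2640 / ln 420)) \<in> \<Omega>(\<lambda>n. real n powr 1.304)"
    using powr_ln_ratio_bigomega[of 60 163 125 7 44 "1.304"] by simp
  show "(\<lambda>n::nat. real n powr (ln 1440 / ln 120)) \<in> \<Omega>(\<lambda>n. real n powr 1.519)"
    using powr_ln_ratio_bigomega[of 120 439 289 1 12 "1.519"] by simp
qed

end
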